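(* Let $r\in\mathbb{R}^m_{++}$, $c\in\mathbb{R}^n_{++}$ have equal total mass one, let $C\in\mathbb{R}^{m\times n}$, $\eta>0$, $K=\exp(-C/\eta)$ (entrywise). Relative to the annealed Sinkhorn recursion with temperatures $\eta_k=\eta/(k+1)$, BDRS makes exactly two modifications, both in the row update. Precisely, let $a^k=\bigodot_{t=0}^k u^t$ and $b^k=\bigodot_{t=0}^k v^t$ be the cumulative scalings of the BDRS iterates $(u^k,v^k,X^{k+1})_{k\ge 0}$, with $b^{-1}=b^{-2}=\mathbf{1}_n$, and define the extrapolated scaling $$\widetilde b^{\,k-1}:=(b^{k-1})^{\odot 2}\oslash b^{k-2}.$$ Then for every $k\ge 0$: (i) (row update) $a^k=\dfrac{r}{K^{\odot(k+1)}\,\widetilde b^{\,k-1}}$, which is the annealed Sinkhorn row update $\dfrac{r}{K^{\odot k}b^{k-1}}$ with $K^{\odot k}$ replaced by $K^{\odot (k+1)}$ and $b^{k-1}$ replaced by $\widetilde b^{\,k-1}$; (ii) the column update and the completed matrix have the annealed Sinkhorn form, $b^k=\dfrac{c}{(K^{\odot(k+1)})^\top a^k}$ and $X^{k+1}=\operatorname{diag}(a^k)K^{\odot(k+1)}\operatorname{diag}(b^k)$; (iii) the second modification is unit inertial extrapolation of the column log scaling: $\log\widetilde b^{\,k-1}=\log b^{k-1}+\left(\log b^{k-1}-\log b^{k-2}\right)$.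
   Context: Notation: $\odot$ and $\oslash$ are entrywise product and quotient, $M^{\odot p}$ the entrywise $p$-th power, fractions of vectors are entrywise quotients, $\exp$ and $\log$ act entrywise, $\mathbf{1}$ denotes all-ones vectors or matrices. BDRS (Bregman Douglas--Rachford splitting for unregularized optimal transport) is the iteration, initialized with $u^{-1}=\mathbf{1}_m$, $v^{-1}=\mathbf{1}_n$, $X^0=\mathbf{1}_{m\times n}$, and for $k=0,1,2,\dots$ $$u^k=\frac{r}{(X^k\odot K)v^{k-1}},\qquad v^k=\frac{c}{(X^k\odot K)^\top u^k},\qquad X^{k+1}=\operatorname{diag}(u^k)(X^k\odot K)\operatorname{diag}(v^k).$$ Annealed Sinkhorn with temperatures $\eta_k$ and kernels $K_k=\exp(-C/\eta_k)$ is the recursion $a^k=r/(K_{k-1}b^{k-1})$, $b^k=c/(K_k^\top a^k)$, $X^{k+1}=\operatorname{diag}(a^k)K_k\operatorname{diag}(b^k)$. For $\eta_k=\eta/(k+1)$ one has $K_k=K^{\odot(k+1)}$, so the row update reads $a^k=r/(K^{\odot k}b^{k-1})$. *)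

theory Defs
  imports "HOL-Analysis.Analysis"
begin

(* On the type of vectors, hence also on matrices as vectors of rows, the type class operations
   *, 1, ^ and the big product are all entrywise, so for matrices * is the Hadamard product, 1 the
   all-ones matrix and M ^ p the entrywise power.  The matrix product is ** and *v. *)

definition entry_div :: "real ^ 'n \<Rightarrow> real ^ 'n \<Rightarrow> real ^ 'n"  (infixl \<open>\<oslash>\<close> 70) where
  "x \<oslash> y = (\<chi> i. x $ i / y $ i)"

definition entry_log :: "real ^ 'n \<Rightarrow> real ^ 'n" where
  "entry_log x = (\<chi> i. ln (x $ i))"

definition diag :: "real ^ 'n \<Rightarrow> real ^ 'n ^ 'n" where
  "diag x = (\<chi> i j. if i = j then x $ i else 0)"

definition gibbs_kernel :: "real ^ 'n ^ 'm \<Rightarrow> real \<Rightarrow> real ^ 'n ^ 'm" where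
  "gibbs_kernel C \<eta> = map_matrix (\<lambda>x. exp (- x / \<eta>)) C"

(* The scalings are indexed by integers because the iteration starts from u^(-1), v^(-1). *)
definition is_bdrs ::
  "real ^ 'm \<Rightarrow> real ^ 'n \<Rightarrow> real ^ 'n ^ 'm \<Rightarrow>
   (int \<Rightarrow> real ^ 'm) \<Rightarrow> (int \<Rightarrow> real ^ 'n) \<Rightarrow> (nat \<Rightarrow> real ^ 'n ^ 'm) \<Rightarrow> bool" where
  "is_bdrs r c K u v X \<longleftrightarrow>
     u (-1) = 1 \<and> v (-1) = 1 \<and> X 0 = 1 \<and>
     (\<forall>k::nat.
        u (int k) = r \<oslash> ((X k * K) *v v (int k - 1)) \<and>
        v (int k) = c \<oslash> (transpose (X k * K) *v u (int k)) \<and>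
        X (k + 1) = diag (u (int k)) ** (X k * K) ** diag (v (int k)))"

lemma is_bdrs_exists:
  fixes r :: "real ^ 'm" and c :: "real ^ 'n"
  shows "\<exists>u v X. is_bdrs r c K u v X"
proof -
  define step where "step = (\<lambda>(u :: real ^ 'm, v :: real ^ 'n, X :: real ^ 'n ^ 'm).
    let u' = r \<oslash> ((X * K) *v v); v' = c \<oslash> (transpose (X * K) *v u')
    in (u', v', diag u' ** (X * K) ** diag v'))"
  define s where "s = rec_nat (1, 1, 1) (\<lambda>_. step)"
  have s0: "s 0 = (1, 1, 1)" and sS: "\<And>k. s (Suc k) = step (s k)"
    by (simp_all add: s_def)
  have "is_bdrs r c K (\<lambda>j. fst (s (nat (j + 1)))) (\<lambda>j. fst (snd (s (nat (j + 1)))))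
          (\<lambda>k. snd (snd (s k)))"
    by (simp add: is_bdrs_def s0 sS step_def Let_def nat_add_distrib split_beta)
  then show ?thesis
    by blast
qed

(* The cumulative scaling at -1 and -2 is an empty product, hence the all-ones vector. *)
definition cumulative :: "(int \<Rightarrow> real ^ 'n) \<Rightarrow> int \<Rightarrow> real ^ 'n" where
  "cumulative w k = (\<Prod>t\<in>{0..k}. w t)"

(* The row update at k = 0 uses the kernel of index -1, for which there is no temperature.
   It is the all-ones kernel, that is, infinite temperature. *)
definition annealed_kernel :: "real ^ 'n ^ 'm \<Rightarrow> (nat \<Rightarrow> real) \<Rightarrow> int \<Rightarrow> real ^ 'n ^ 'm" where
  "annealed_kernel C temp k = (if k < 0 then 1 else gibbs_kernel C (temp (nat k)))"

(* The starting value b (-1) is left free. *)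
definition is_annealed_sinkhorn ::
  "real ^ 'm \<Rightarrow> real ^ 'n \<Rightarrow> real ^ 'n ^ 'm \<Rightarrow> (nat \<Rightarrow> real) \<Rightarrow>
   (int \<Rightarrow> real ^ 'm) \<Rightarrow> (int \<Rightarrow> real ^ 'n) \<Rightarrow> (nat \<Rightarrow> real ^ 'n ^ 'm) \<Rightarrow> bool" where
  "is_annealed_sinkhorn r c C temp a b X \<longleftrightarrow>
     (\<forall>k::nat.
        a (int k) = r \<oslash> (annealed_kernel C temp (int k - 1) *v b (int k - 1)) \<and>
        b (int k) = c \<oslash> (transpose (annealed_kernel C temp (int k)) *v a (int k)) \<and>
        X (k + 1) = diag (a (int k)) ** annealed_kernel C temp (int k) ** diag (b (int k)))"

end

theory Submission
  imports Defs
begin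

text \<open>
  Write \<open>a\<close>, \<open>b\<close> for the cumulative scalings. By induction on \<open>k\<close>, the iterate \<open>X\<close> of index \<open>k\<close> is the
  diagonal scaling by \<open>a (k - 1)\<close> and \<open>b (k - 1)\<close> of the \<open>k\<close>-th entrywise power of \<open>K\<close>, and all
  scalings are positive. The factor \<open>a (k - 1)\<close> of the row denominator cancels against the one in
  \<open>a k = a (k - 1) * u k\<close>, and the remaining vector \<open>b (k - 1) * v (k - 1)\<close> is the extrapolated
  scaling because \<open>v (k - 1) = b (k - 1) / b (k - 2)\<close>; similarly for the columns.
\<close>

lemma entry_div_component [simp]: "(x \<oslash> y) $ i = x $ i / y $ i"
  by (simp add: entry_div_def)

lemma power_component: "(x ^ k) $ i = (x $ i) ^ k"
  for x :: "'a::comm_ring_1 ^ 'n"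
  by (induction k) auto

lemma diag_scaling_component:
  fixes A :: "real ^ 'n ^ 'm"
  shows "(diag x ** A ** diag y) $ i $ j = x $ i * A $ i $ j * y $ j"
proof -
  have "(diag x ** A) $ i $ j = x $ i * A $ i $ j"
    by (simp add: matrix_matrix_mult_def diag_def if_distrib [where f = "\<lambda>z. z * _"] cong: if_cong)
  moreover have "(M ** diag y) $ i $ j = M $ i $ j * y $ j" for M :: "real ^ 'n ^ 'm"
    by (simp add: matrix_matrix_mult_def diag_def if_distrib [where f = "\<lambda>z. _ * z"] cong: if_cong)
  ultimately show ?thesis
    by simp
qed

lemma matrix_vector_mult_pos:
  fixes A :: "real ^ 'n ^ 'm"
  assumes "\<And>i j. 0 < A $ i $ j" and "\<And>j. 0 < x $ j"
  shows "0 < (A *v x) $ i"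
  using assms by (auto simp: matrix_vector_mult_def intro!: sum_pos)

text \<open>The row scaling comes out as an entrywise factor, which can then cancel in a quotient,
  while the column scaling is absorbed into the vector.\<close>

lemma diag_scaling_mult_vec: "(diag x ** A ** diag y) *v z = x * (A *v (y * z))"
  by (simp add: vec_eq_iff matrix_vector_mult_def diag_scaling_component sum_distrib_left mult_ac)

lemma transpose_diag_scaling:
  "transpose (diag x ** A ** diag y) = diag y ** transpose A ** diag x"
  by (simp add: vec_eq_iff diag_scaling_component transpose_def mult_ac)

lemma diag_scaling_diag_scaling:
  "diag x ** (diag x' ** A ** diag y') ** diag y = diag (x' * x) ** A ** diag (y' * y)"
  by (simp add: vec_eq_iff diag_scaling_component mult_ac)

text \<open>Scaling rows and columns is itself entrywise, hence commutes with the Hadamard product.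
  This is how each step raises the power of \<open>K\<close> by one.\<close>

lemma diag_scaling_times: "(diag x ** A ** diag y) * B = diag x ** (A * B) ** diag y"
  by (simp add: vec_eq_iff diag_scaling_component mult_ac)

lemma cumulative_neg: "k < 0 \<Longrightarrow> cumulative w k = 1"
  by (simp add: cumulative_def)

lemma cumulative_rec:
  assumes "0 \<le> k"
  shows "cumulative w k = cumulative w (k - 1) * w k"
proof -
  have "{0..k} = insert k {0..k - 1}"
    using assms by auto
  then show ?thesis
    by (simp add: cumulative_def mult.commute)
qed

lemma gibbs_kernel_pos: "0 < gibbs_kernel C \<eta> $ i $ j"
  by (simp add: gibbs_kernel_def map_matrix_def)

text \<open>For \<open>k = 0\<close> both sides are the all-ones matrix, because \<open>x / 0 = 0\<close>.\<close>

lemma gibbs_kernel_power: "gibbs_kernel C \<eta> ^ k = gibbs_kernel C (\<eta> / real k)"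
  by (simp add: vec_eq_iff power_component gibbs_kernel_def map_matrix_def mult_ac
      flip: exp_of_nat_mult)

text \<open>The kernel of index \<open>-1\<close> fits the pattern: it is the all-ones matrix, which
  is the zeroth entrywise power.\<close>

lemma annealed_kernel_eq_power:
  "annealed_kernel C (\<lambda>k. \<eta> / (real k + 1)) (int k) = gibbs_kernel C \<eta> ^ (k + 1)"
  "annealed_kernel C (\<lambda>k. \<eta> / (real k + 1)) (int k - 1) = gibbs_kernel C \<eta> ^ k"
  by (cases k; simp add: annealed_kernel_def gibbs_kernel_power add.commute del: power_Suc)+

lemma bdrs_step:
  fixes K :: "real ^ 'n ^ 'm"
  assumes "is_bdrs r c K u v X"
  shows "u (int k) = r \<oslash> ((X k * K) *v v (int k - 1))"
    and "v (int k) = c \<oslash> (transpose (X k * K) *v u (int k))"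
    and "X (k + 1) = diag (u (int k)) ** (X k * K) ** diag (v (int k))"
  using assms unfolding is_bdrs_def by blast+

text \<open>The induction step: positivity justifies the cancellations, and the last four
  conclusions are \<open>X\<close> and \<open>pos\<close> again at \<open>k + 1\<close>.\<close>

lemma cumulative_bdrs_step:
  fixes r :: "real ^ 'm" and c :: "real ^ 'n" and K :: "real ^ 'n ^ 'm"
  assumes r: "\<And>i. 0 < r $ i" and c: "\<And>j. 0 < c $ j" and K: "\<And>i j. 0 < K $ i $ j"
    and bdrs: "is_bdrs r c K u v X"
    and a: "a = cumulative u" and b: "b = cumulative v"
    and X: "X k = diag (a (int k - 1)) ** K ^ k ** diag (b (int k - 1))"
    and pos: "\<And>i. 0 < a (int k - 1) $ i" "\<And>j. 0 < b (int k - 1) $ j" "\<And>j. 0 < v (int k - 1) $ j"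
  shows "a (int k) = r \<oslash> (K ^ (k + 1) *v (b (int k - 1) * v (int k - 1)))"
    and "b (int k) = c \<oslash> (transpose (K ^ (k + 1)) *v a (int k))"
    and "X (k + 1) = diag (a (int k)) ** K ^ (k + 1) ** diag (b (int k))"
    and "\<And>i. 0 < a (int k) $ i" and "\<And>j. 0 < b (int k) $ j" and "\<And>j. 0 < v (int k) $ j"
proof -
  have XK: "X k * K = diag (a (int k - 1)) ** K ^ (k + 1) ** diag (b (int k - 1))"
    by (simp only: X diag_scaling_times power_add power_one_right)
  have ak: "a (int k) = a (int k - 1) * u (int k)" and bk: "b (int k) = b (int k - 1) * v (int k)"
    by (simp_all add: a b cumulative_rec)
  have Kpos: "0 < (K ^ (k + 1)) $ i $ j" for i j
    by (simp only: power_component zero_less_power K)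
  show row: "a (int k) = r \<oslash> (K ^ (k + 1) *v (b (int k - 1) * v (int k - 1)))"
    using pos(1) unfolding ak bdrs_step(1) [OF bdrs] XK diag_scaling_mult_vec
    by (simp add: vec_eq_iff less_imp_neq [symmetric] del: power_Suc)
  show apos: "0 < a (int k) $ i" for i
    unfolding row using r Kpos pos by (simp add: matrix_vector_mult_pos del: power_Suc)
  \<comment> \<open>The column update sees the new \<open>u k\<close>, which completes
    \<open>a (k - 1)\<close> to \<open>a k\<close>. The row update sees the old
    \<open>v (k - 1)\<close>, whence the extrapolation there only.\<close>
  have v: "v (int k) = c \<oslash> (b (int k - 1) * (transpose (K ^ (k + 1)) *v a (int k)))"
    unfolding bdrs_step(2) [OF bdrs, of k] XK transpose_diag_scaling diag_scaling_mult_vec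
    by (simp only: ak)
  show col: "b (int k) = c \<oslash> (transpose (K ^ (k + 1)) *v a (int k))"
    using pos(2) unfolding bk v
    by (simp add: vec_eq_iff less_imp_neq [symmetric] del: power_Suc)
  have den: "0 < (transpose (K ^ (k + 1)) *v a (int k)) $ j" for j
    by (rule matrix_vector_mult_pos) (use Kpos apos in \<open>simp_all add: transpose_def del: power_Suc\<close>)
  show "0 < b (int k) $ j" for j
    unfolding col using c den by (simp del: power_Suc)
  \<comment> \<open>Used at the next step, where \<open>v k\<close> enters the row
    denominator.\<close>
  show "0 < v (int k) $ j" for j
    unfolding v using c den pos by (simp del: power_Suc)
  show "X (k + 1) = diag (a (int k)) ** K ^ (k + 1) ** diag (b (int k))"
    unfolding bdrs_step(3) [OF bdrs] XK diag_scaling_diag_scaling ak bk ..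
qed

lemma cumulative_bdrs_invariant:
  fixes r :: "real ^ 'm" and c :: "real ^ 'n" and K :: "real ^ 'n ^ 'm"
  assumes r: "\<And>i. 0 < r $ i" and c: "\<And>j. 0 < c $ j" and K: "\<And>i j. 0 < K $ i $ j"
    and bdrs: "is_bdrs r c K u v X"
    and a: "a = cumulative u" and b: "b = cumulative v"
  shows "X k = diag (a (int k - 1)) ** K ^ k ** diag (b (int k - 1)) \<and>
    (\<forall>i. 0 < a (int k - 1) $ i) \<and> (\<forall>j. 0 < b (int k - 1) $ j) \<and> (\<forall>j. 0 < v (int k - 1) $ j)"
proof (induction k)
  case 0
  then show ?case
    using bdrs by (simp add: is_bdrs_def a b cumulative_neg vec_eq_iff diag_scaling_component)
next
  case (Suc k)
  then show ?case
    using cumulative_bdrs_step(3-6) [OF r c K bdrs a b, of k] by simp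
qed

text \<open>For \<open>k \<ge> 0\<close> the quotient of consecutive cumulative products is
  \<open>v k\<close>. At \<open>k = -1\<close> both products are empty, and the starting value
  \<open>v (-1) = 1\<close> makes the two sides agree.\<close>

lemma cumulative_extrapolation:
  fixes v :: "int \<Rightarrow> real ^ 'n"
  assumes "\<And>j. 0 < cumulative v k $ j" and "-1 \<le> k" and "v (-1) = 1"
  shows "(cumulative v k)\<^sup>2 \<oslash> cumulative v (k - 1) = cumulative v k * v k"
proof (cases "k = -1")
  case True
  then show ?thesis
    using assms(3) by (simp add: cumulative_neg vec_eq_iff)
next
  case False
  then have "cumulative v k = cumulative v (k - 1) * v k"
    using assms(2) by (intro cumulative_rec) simp
  moreover from this have "cumulative v (k - 1) $ j \<noteq> 0" for j
    using assms(1) [of j] by auto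
  ultimately show ?thesis
    by (simp add: vec_eq_iff power_component power2_eq_square)
qed

lemma entry_log_extrapolation:
  assumes "\<And>i. 0 < x $ i" and "\<And>i. 0 < y $ i"
  shows "entry_log (x\<^sup>2 \<oslash> y) = entry_log x + (entry_log x - entry_log y)"
  using assms
  by (simp add: vec_eq_iff entry_log_def power_component ln_div ln_realpow less_imp_neq [symmetric])

theorem corollary1:
  fixes r :: "real ^ 'm" and c :: "real ^ 'n" and C K :: "real ^ 'n ^ 'm" and \<eta> :: real
    and u a :: "int \<Rightarrow> real ^ 'm" and v b b_ext :: "int \<Rightarrow> real ^ 'n"
    and X :: "nat \<Rightarrow> real ^ 'n ^ 'm"
  assumes "\<And>i. 0 < r $ i" and "\<And>j. 0 < c $ j"
    and "(\<Sum>i\<in>UNIV. r $ i) = 1" and "(\<Sum>j\<in>UNIV. c $ j) = 1"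
    and "0 < \<eta>"
    and "K = gibbs_kernel C \<eta>"
    and "is_bdrs r c K u v X"
    and "a = cumulative u" and "b = cumulative v"
    and "b_ext = (\<lambda>j. (b j)\<^sup>2 \<oslash> b (j - 1))"
  shows
    "(\<forall>a' b' X'. is_annealed_sinkhorn r c C (\<lambda>k. \<eta> / (real k + 1)) a' b' X' \<longleftrightarrow>
        (\<forall>k::nat.
           a' (int k) = r \<oslash> (K ^ k *v b' (int k - 1)) \<and>
           b' (int k) = c \<oslash> (transpose (K ^ (k + 1)) *v a' (int k)) \<and>
           X' (k + 1) = diag (a' (int k)) ** K ^ (k + 1) ** diag (b' (int k)))) \<and>
     b (-1) = 1 \<and> b (-2) = 1 \<and>
     (\<forall>k::nat.
        a (int k) = r \<oslash> (K ^ (k + 1) *v b_ext (int k - 1)) \<and>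
        b (int k) = c \<oslash> (transpose (K ^ (k + 1)) *v a (int k)) \<and>
        X (k + 1) = diag (a (int k)) ** K ^ (k + 1) ** diag (b (int k)) \<and>
        entry_log (b_ext (int k - 1)) =
          entry_log (b (int k - 1)) + (entry_log (b (int k - 1)) - entry_log (b (int k - 2))))"
proof -
  note [simp del] = power_Suc
  have K: "0 < K $ i $ j" for i j
    by (simp add: assms(6) gibbs_kernel_pos)
  note inv = cumulative_bdrs_invariant [OF assms(1,2) K assms(7-9)]
  note step = cumulative_bdrs_step [OF assms(1,2) K assms(7-9)]
  have v: "v (-1) = 1"
    using assms(7) by (simp add: is_bdrs_def)
  have b: "b (-1) = 1" "b (-2) = 1"
    by (simp_all add: assms(9) cumulative_neg)
  have bpos: "0 < b (int k - 1) $ j" for k j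
    using inv by blast
  \<comment> \<open>Shifting the index covers all \<open>k\<close> but \<open>0\<close>, where
    \<open>b (-2)\<close> is the all-ones vector.\<close>
  have bpos': "0 < b (int k - 2) $ j" for k j
    using bpos [of "k - 1"] b by (cases k) auto
  have ext: "b_ext (int k - 1) = b (int k - 1) * v (int k - 1)" for k
    unfolding assms(9,10) using bpos [unfolded assms(9)] v by (intro cumulative_extrapolation) auto
  have log: "entry_log (b_ext (int k - 1)) =
      entry_log (b (int k - 1)) + (entry_log (b (int k - 1)) - entry_log (b (int k - 2)))" for k
    using entry_log_extrapolation [OF bpos bpos', of k k] by (simp add: assms(10))
  \<comment> \<open>Once the kernels are written as powers of \<open>K\<close>, the unfolded
    annealed recursion is the right-hand side of the stated equivalence.\<close>
  show ?thesis
    unfolding is_annealed_sinkhorn_def annealed_kernel_eq_power ext [symmetric] assms(6) [symmetric]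
    using b log step(1-3) inv ext by auto
qed

end
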